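(* Consider a college admissions problem in which all colleges share the common strict priority order induced by students' scores, and suppose that all students follow straightforward strategies. If the application process of the time-constrained dynamic mechanism (TCDM) is allowed to continue (with no deadline) until no student revises her application, it reaches the unique stable matching after at most $|I|$ rounds. Hence, if the number of rounds satisfies $T\ge |I|$, the final outcome $\mu^T$ of the $T$-round TCDM coincides with the unique stable matching.
   Context: Problem. $I$ is a finite set of students and $C$ a finite set of colleges. Each student $i$ has a strict preference (linear order) $\succ_i$ over $C\cup\{\emptyset\}$, where $\emptyset$ is the outside option (being unassigned). Each college $c$ has capacity $q_c\in\mathbb{N}_+$. Each student has a score $s_i>0$, scores are distinct, and every college uses the common strict priority order $i\triangleright j\iff s_i>s_j$. Matching and stability. A matching is a map $\mu:I\to C\cup\{\emptyset\}$ with $|\mu^{-1}(c)|\le q_c$ for all $c\in C$. Student $i$ blocks $\mu$ if $\emptyset\succ_i\mu(i)$. A pair $(i,c)$ blocks $\mu$ if $c\succ_i\mu(i)$ and either $|\mu^{-1}(c)|<q_c$ or there is $j\in\mu^{-1}(c)$ with $i\triangleright j$. $\mu$ is stable if no student and no student-college pair blocks it. (With a common priority order there is exactly one stable matching.) The cutoff of $c$ at $\mu$ is $f_c(\mu)=\min\{s_i:i\in\mu^{-1}(c)\}$ if $|\mu^{-1}(c)|=q_c$, and $f_c(\mu)=0$ if $|\mu^{-1}(c)|<q_c$. TCDM. In each round every student chooses one element of $C\cup\{\emptyset\}$ (her application for that round, replacing any earlier one). Given the current application profile, each college tentatively holds its highest-priority current applicants up to capacity and rejects the others; this defines the tentative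 matching $\mu^t$ of round $t$ (students who are rejected or chose $\emptyset$ are unassigned). Write $f_c^t=f_c(\mu^t)$. After round $T$ the matching $\mu^T$ is final. Straightforward strategy. In round 1 student $i$ applies to her $\succ_i$-best element of $C\cup\{\emptyset\}$. In round $t>1$: if $\mu^{t-1}(i)\in C$, she applies again to $\mu^{t-1}(i)$; if $\mu^{t-1}(i)=\emptyset$, she chooses her $\succ_i$-best element of $\{c\in C: s_i\ge f_c^{t-1}\}\cup\{\emptyset\}$. *)

theory Defs
  imports Complex_Main
begin

text \<open>
  The outside option is \<open>None\<close>, and \<open>prefers M i x y\<close> reads ``student \<open>i\<close> strictly prefers
  \<open>x\<close> to \<open>y\<close>''.
\<close>

record ('i, 'c) market =
  students :: "'i set"
  colleges :: "'c set"
  prefers :: "'i \<Rightarrow> 'c option \<Rightarrow> 'c option \<Rightarrow> bool"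
  quota :: "'c \<Rightarrow> nat"
  score :: "'i \<Rightarrow> real"

definition options :: "('i, 'c) market \<Rightarrow> 'c option set" where
  "options M = insert None (Some ` colleges M)"

definition college_admissions :: "('i, 'c) market \<Rightarrow> bool" where
  "college_admissions M \<longleftrightarrow>
     finite (students M) \<and> finite (colleges M) \<and>
     (\<forall>i\<in>students M. irreflp_on (options M) (prefers M i) \<and>
        transp_on (options M) (prefers M i) \<and> totalp_on (options M) (prefers M i)) \<and>
     (\<forall>c\<in>colleges M. 0 < quota M c) \<and>
     (\<forall>i\<in>students M. 0 < score M i) \<and>
     inj_on (score M) (students M)"

definition priority :: "('i, 'c) market \<Rightarrow> 'i \<Rightarrow> 'i \<Rightarrow> bool" where
  "priority M i j \<longleftrightarrow> score M i > score M j"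

definition assigned :: "('i, 'c) market \<Rightarrow> ('i \<Rightarrow> 'c option) \<Rightarrow> 'c \<Rightarrow> 'i set" where
  "assigned M \<mu> c = {i \<in> students M. \<mu> i = Some c}"

text \<open>
  A map on the set of students is represented by the total function that takes the value \<open>None\<close>
  outside this set, so that equality of functions is equality of matchings.
\<close>

definition matching :: "('i, 'c) market \<Rightarrow> ('i \<Rightarrow> 'c option) \<Rightarrow> bool" where
  "matching M \<mu> \<longleftrightarrow>
     (\<forall>i\<in>students M. \<mu> i \<in> options M) \<and> (\<forall>i. i \<notin> students M \<longrightarrow> \<mu> i = None) \<and>
     (\<forall>c\<in>colleges M. card (assigned M \<mu> c) \<le> quota M c)"

definition student_blocks :: "('i, 'c) market \<Rightarrow> ('i \<Rightarrow> 'c option) \<Rightarrow> 'i \<Rightarrow> bool" where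
  "student_blocks M \<mu> i \<longleftrightarrow> prefers M i None (\<mu> i)"

definition pair_blocks :: "('i, 'c) market \<Rightarrow> ('i \<Rightarrow> 'c option) \<Rightarrow> 'i \<Rightarrow> 'c \<Rightarrow> bool" where
  "pair_blocks M \<mu> i c \<longleftrightarrow> prefers M i (Some c) (\<mu> i) \<and>
     (card (assigned M \<mu> c) < quota M c \<or> (\<exists>j\<in>assigned M \<mu> c. priority M i j))"

definition stable_matching :: "('i, 'c) market \<Rightarrow> ('i \<Rightarrow> 'c option) \<Rightarrow> bool" where
  "stable_matching M \<mu> \<longleftrightarrow> matching M \<mu> \<and>
     (\<forall>i\<in>students M. \<not> student_blocks M \<mu> i) \<and>
     (\<forall>i\<in>students M. \<forall>c\<in>colleges M. \<not> pair_blocks M \<mu> i c)"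

definition cutoff :: "('i, 'c) market \<Rightarrow> ('i \<Rightarrow> 'c option) \<Rightarrow> 'c \<Rightarrow> real" where
  "cutoff M \<mu> c =
     (if card (assigned M \<mu> c) = quota M c then Min (score M ` assigned M \<mu> c) else 0)"

text \<open>
  \<open>held M a c\<close> is the set of the highest-priority applicants to \<open>c\<close> under the application profile
  \<open>a\<close>, up to the capacity: those outranked by fewer than \<open>quota M c\<close> other applicants.  The lemmas
  \<open>held_subset\<close>, \<open>card_held\<close> and \<open>held_priority\<close> confirm that this is the intended choice set.
\<close>

definition held :: "('i, 'c) market \<Rightarrow> ('i \<Rightarrow> 'c option) \<Rightarrow> 'c \<Rightarrow> 'i set" where
  "held M a c =
     {i \<in> assigned M a c. card {j \<in> assigned M a c. priority M j i} < quota M c}"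

definition tentative :: "('i, 'c) market \<Rightarrow> ('i \<Rightarrow> 'c option) \<Rightarrow> ('i \<Rightarrow> 'c option)" where
  "tentative M a i =
     (case a i of None \<Rightarrow> None | Some c \<Rightarrow> (if i \<in> held M a c then Some c else None))"

definition is_best :: "('i, 'c) market \<Rightarrow> 'i \<Rightarrow> 'c option set \<Rightarrow> 'c option \<Rightarrow> bool" where
  "is_best M i A x \<longleftrightarrow> x \<in> A \<and> (\<forall>y\<in>A. y \<noteq> x \<longrightarrow> prefers M i x y)"

text \<open>
  A play is a sequence \<open>a\<close> in which \<open>a t i\<close> is the application of student \<open>i\<close> in round
  \<open>t \<ge> 1\<close>; the value \<open>a 0\<close> has no meaning.  The tentative matching of round \<open>t\<close> is
  \<open>tentative M (a t)\<close>.
\<close>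

definition straightforward ::
  "('i, 'c) market \<Rightarrow> (nat \<Rightarrow> 'i \<Rightarrow> 'c option) \<Rightarrow> 'i \<Rightarrow> nat \<Rightarrow> bool" where
  "straightforward M a i t \<longleftrightarrow>
     (if t = 1 then is_best M i (options M) (a t i)
      else let \<mu> = tentative M (a (t - 1)) in
        if \<mu> i \<noteq> None then a t i = \<mu> i
        else is_best M i (insert None (Some ` {c \<in> colleges M. score M i \<ge> cutoff M \<mu> c})) (a t i))"

text \<open>
  A round counts as one without a revision if each student repeats her application of the
  previous round; a first application, made in round 1, counts as a revision.  Without a deadline,
  the process ends after round \<open>R\<close> if round \<open>R + 1\<close> is the first one without a revision.  (The case
  \<open>R = 0\<close> occurs only if there are no students.)
\<close>

definition revises :: "(nat \<Rightarrow> 'i \<Rightarrow> 'c option) \<Rightarrow> 'i \<Rightarrow> nat \<Rightarrow> bool" where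
  "revises a i t \<longleftrightarrow> t = 1 \<or> a t i \<noteq> a (t - 1) i"

definition ends_after :: "('i, 'c) market \<Rightarrow> (nat \<Rightarrow> 'i \<Rightarrow> 'c option) \<Rightarrow> nat \<Rightarrow> bool" where
  "ends_after M a R \<longleftrightarrow>
     (\<forall>i\<in>students M. \<not> revises a i (R + 1)) \<and>
     (\<forall>t\<in>{1..R}. \<exists>i\<in>students M. revises a i t)"

lemma held_subset: "held M a c \<subseteq> assigned M a c"
  by (auto simp: held_def)

lemma card_held:
  assumes "college_admissions M"
  shows "card (held M a c) = min (quota M c) (card (assigned M a c))"
proof -
  have rank: "card {i\<in>A. card {j\<in>A. f i < f j} < q} = min q (card A)"
    if "finite A" "inj_on f A" for A :: "'i set" and f :: "'i \<Rightarrow> real" and q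
    using that
  proof (induction rule: finite_ranking_induct[where f = "\<lambda>x. - f x"])
    case empty
    then show ?case by simp
  next
    case (insert x S)
    show ?case
    proof (cases "x \<in> S")
      case True
      then show ?thesis using insert by (simp add: insert_absorb)
    next
      case False
      have low: "f x < f y" if "y \<in> S" for y
        using insert.hyps(2)[OF that] insert.prems that False
        by (metis inj_on_contraD insertI1 insertI2 neg_le_iff_le order_less_le)
      have a: "{j \<in> insert x S. f i < f j} = {j \<in> S. f i < f j}" if "i \<in> S" for i
        using low[OF that] by auto
      have b: "{j \<in> insert x S. f x < f j} = S"
        using low by auto
      have eq: "{i \<in> insert x S. card {j \<in> insert x S. f i < f j} < q} =
          (if card S < q then insert x {i \<in> S. card {j \<in> S. f i < f j} < q}
           else {i \<in> S. card {j \<in> S. f i < f j} < q})"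
        using a b by auto
      show ?thesis
        unfolding eq using insert False by auto
    qed
  qed
  have "finite (assigned M a c)" "inj_on (score M) (assigned M a c)"
    using assms by (auto simp: college_admissions_def assigned_def intro: inj_on_subset)
  from rank[OF this] show ?thesis
    by (simp add: held_def priority_def)
qed

lemma held_priority:
  assumes "college_admissions M" "i \<in> held M a c" "j \<in> assigned M a c - held M a c"
  shows "priority M i j"
proof (rule ccontr)
  assume *: "\<not> priority M i j"
  have "{k \<in> assigned M a c. priority M k j} \<subseteq> {k \<in> assigned M a c. priority M k i}"
    using * by (auto simp: priority_def)
  then have "card {k \<in> assigned M a c. priority M k j} \<le> card {k \<in> assigned M a c. priority M k i}"
    using assms(1) by (intro card_mono) (auto simp: college_admissions_def assigned_def)
  then show False
    using assms(2,3) by (auto simp: held_def)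
qed

lemma is_best_exists:
  assumes M: "college_admissions M" "i \<in> students M"
    and A: "A \<subseteq> options M" "A \<noteq> {}"
  shows "\<exists>x. is_best M i A x"
proof -
  have "finite A"
    using M A by (auto simp: college_admissions_def options_def intro: finite_subset)
  then show ?thesis
    using A(2,1)
  proof (induction rule: finite_ne_induct)
    case (singleton x)
    then show ?case by (auto simp: is_best_def)
  next
    case (insert x F)
    then obtain b where b: "is_best M i F b" by auto
    have tot: "totalp_on (options M) (prefers M i)" and tr: "transp_on (options M) (prefers M i)"
      using M by (auto simp: college_admissions_def)
    have mem: "x \<in> options M" "b \<in> options M" "F \<subseteq> options M" "b \<in> F" "b \<noteq> x"
      using insert b by (auto simp: is_best_def)
    show ?case
    proof (cases "prefers M i x b")
      case True
      have "prefers M i x y" if "y \<in> F" for y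
        using that True b mem tr by (cases "y = b") (auto simp: is_best_def dest: transp_onD)
      then show ?thesis by (auto simp: is_best_def)
    next
      case False
      then have "prefers M i b x"
        using tot mem by (metis totalp_onD)
      then show ?thesis using b by (auto simp: is_best_def)
    qed
  qed
qed

lemma straightforward_play_exists:
  assumes M: "college_admissions M"
  shows "\<exists>a. \<forall>i\<in>students M. \<forall>t\<ge>1. straightforward M a i t"
proof -
  define next_appl where "next_appl p i = (let \<mu> = tentative M p in
    if \<mu> i \<noteq> None then \<mu> i
    else SOME x. is_best M i (insert None (Some ` {c \<in> colleges M. score M i \<ge> cutoff M \<mu> c})) x)"
    for p i
  define a where "a t = (next_appl ^^ (t - 1)) (\<lambda>i. SOME x. is_best M i (options M) x)" for t
  have "straightforward M a i t" if i: "i \<in> students M" and "t \<ge> 1" for i t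
  proof (cases "t = 1")
    case True
    then show ?thesis
      using is_best_exists[OF M i, of "options M"]
      by (auto simp: straightforward_def a_def options_def intro: someI_ex)
  next
    case False
    then obtain n where n: "t = Suc (Suc n)"
      using \<open>t \<ge> 1\<close> by (metis One_nat_def not0_implies_Suc not_one_le_zero)
    have "a t = next_appl (a (t - 1))"
      by (simp add: a_def n)
    moreover have "\<exists>x. is_best M i (insert None (Some ` {c \<in> colleges M. P c})) x" for P
      by (rule is_best_exists[OF M i]) (auto simp: options_def)
    ultimately show ?thesis
      using False by (auto simp: straightforward_def next_appl_def Let_def intro: someI_ex)
  qed
  then show ?thesis by blast
qed

end

theory Submission
  imports Defs
begin

text \<open>
  A matching is stable iff each student receives her best option among the colleges not filled by
  students of higher priority, as in serial dictatorship; this determines it by induction along the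
  priority order.  At a tentative matching, a college's cutoff is at most a student's score iff the
  college is not filled by higher-priority applicants.  These sets of available colleges shrink from
  round to round, so an application is never worse than any option still available, and can fail to
  be optimal only by being unavailable.  Once all students of higher priority repeat their
  applications, a student's current application is available in the next round.  Hence at least one
  further student settles in every round.
\<close>

section \<open>Available options and serial profiles\<close>

text \<open>The profile \<open>\<nu>\<close> may exceed capacities: besides matchings it also stands
  for application profiles, in which colleges can be oversubscribed.\<close>

definition avail :: "('i, 'c) market \<Rightarrow> ('i \<Rightarrow> 'c option) \<Rightarrow> 'i \<Rightarrow> 'c option set" where
  "avail M \<nu> i = insert None
     (Some ` {c \<in> colleges M. card {j \<in> assigned M \<nu> c. priority M j i} < quota M c})"

text \<open>Serial dictatorship as a fixed-point condition. Values outside \<open>students M\<close>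
  stay free, so that application profiles qualify; \<open>tentative\<close> later resets them to
  \<open>None\<close>.\<close>

definition serial :: "('i, 'c) market \<Rightarrow> ('i \<Rightarrow> 'c option) \<Rightarrow> bool" where
  "serial M \<nu> \<longleftrightarrow> (\<forall>i\<in>students M. is_best M i (avail M \<nu> i) (\<nu> i))"

definition rank :: "('i, 'c) market \<Rightarrow> 'i \<Rightarrow> nat" where
  "rank M i = card {j \<in> students M. priority M j i}"

lemma avail_subset: "avail M \<nu> i \<subseteq> options M"
  by (auto simp: avail_def options_def)

lemma None_in_avail [simp]: "None \<in> avail M \<nu> i"
  by (simp add: avail_def)

lemma Some_in_avail:
  "Some c \<in> avail M \<nu> i \<longleftrightarrow>
     c \<in> colleges M \<and> card {j \<in> assigned M \<nu> c. priority M j i} < quota M c"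
  by (auto simp: avail_def)

lemma avail_cong:
  assumes "\<And>j. j \<in> students M \<Longrightarrow> priority M j i \<Longrightarrow> \<nu> j = \<nu>' j"
  shows "avail M \<nu> i = avail M \<nu>' i"
proof -
  have "{j \<in> assigned M \<nu> c. priority M j i} = {j \<in> assigned M \<nu>' c. priority M j i}" for c
    using assms by (auto simp: assigned_def)
  then show ?thesis by (simp add: avail_def)
qed

lemma assigned_tentative: "assigned M (tentative M a) c = held M a c"
  by (auto simp: assigned_def tentative_def held_def split: option.splits if_splits)

lemma tentative_cases: "tentative M a i = None \<or> tentative M a i = a i"
  by (auto simp: tentative_def split: option.splits)

lemma tentative_cong:
  assumes "\<And>i. i \<in> students M \<Longrightarrow> a i = b i"
  shows "tentative M a = tentative M b"
proof
  fix i
  have "assigned M a c = assigned M b c" for c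
    using assms by (auto simp: assigned_def)
  then have h: "held M a c = held M b c" for c
    by (simp add: held_def)
  show "tentative M a i = tentative M b i"
  proof (cases "i \<in> students M")
    case True
    then show ?thesis using assms h by (simp add: tentative_def split: option.split)
  next
    case False
    then have "i \<notin> held M a c" "i \<notin> held M b c" for c
      by (auto simp: held_def assigned_def)
    then show ?thesis by (simp add: tentative_def split: option.splits)
  qed
qed

section \<open>Preferences, priorities and ranks in a fixed market\<close>

context
  fixes M :: "('i, 'c) market"
  assumes M: "college_admissions M"
begin

lemma finite_students: "finite (students M)"
  using M by (simp add: college_admissions_def)

lemma finite_assigned: "finite (assigned M a c)"
  using finite_students by (simp add: assigned_def)

lemma prefers_asym:
  assumes "i \<in> students M" "x \<in> options M" "y \<in> options M" "prefers M i x y"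
  shows "\<not> prefers M i y x"
  using M assms unfolding college_admissions_def by (meson irreflp_onD transp_onD)

lemma prefers_total:
  assumes "i \<in> students M" "x \<in> options M" "y \<in> options M" "x \<noteq> y"
  shows "prefers M i x y \<or> prefers M i y x"
  using M assms unfolding college_admissions_def by (metis totalp_onD)

lemma is_best_unique:
  assumes "i \<in> students M" "A \<subseteq> options M" "is_best M i A x" "is_best M i A y"
  shows "x = y"
  using assms prefers_asym[OF assms(1)] unfolding is_best_def by (metis subsetD)

lemma priority_total:
  assumes "i \<in> students M" "j \<in> students M" "i \<noteq> j"
  shows "priority M i j \<or> priority M j i"
  using M assms unfolding college_admissions_def priority_def
  by (meson inj_onD linorder_neqE)

lemma rank_mono:
  assumes "j \<in> students M" "priority M j i"
  shows "rank M j < rank M i"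
  unfolding rank_def
  by (rule psubset_card_mono) (use assms finite_students in \<open>auto simp: priority_def\<close>)

lemma rank_less_card:
  assumes "i \<in> students M"
  shows "rank M i < card (students M)"
  unfolding rank_def
  by (rule psubset_card_mono) (use assms finite_students in \<open>auto simp: priority_def\<close>)

section \<open>Serial profiles and stable matchings\<close>

text \<open>Optimality is assumed only for \<open>i\<close> and those above her, so that two rounds
  of a play can be compared while lower students are still unsettled. Agreement above
  \<open>i\<close> makes both available sets equal, and a best element is unique.\<close>

lemma avail_best_unique:
  assumes "i \<in> students M"
    and "\<And>j. j \<in> students M \<Longrightarrow> j = i \<or> priority M j i \<Longrightarrow> is_best M j (avail M \<nu> j) (\<nu> j)"
    and "\<And>j. j \<in> students M \<Longrightarrow> j = i \<or> priority M j i \<Longrightarrow> is_best M j (avail M \<nu>' j) (\<nu>' j)"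
  shows "\<nu> i = \<nu>' i"
  using assms
proof (induction "rank M i" arbitrary: i rule: less_induct)
  case less
  have "\<nu> j = \<nu>' j" if j: "j \<in> students M" "priority M j i" for j
  proof (rule less.hyps)
    show "rank M j < rank M i" using rank_mono j .
    show "j \<in> students M" by fact
    show "is_best M k (avail M \<nu> k) (\<nu> k)" "is_best M k (avail M \<nu>' k) (\<nu>' k)"
      if "k \<in> students M" "k = j \<or> priority M k j" for k
      using less.prems(2,3) that j by (auto simp: priority_def)
  qed
  then have "avail M \<nu> i = avail M \<nu>' i"
    by (rule avail_cong)
  then show ?case
    using is_best_unique[OF less.prems(1) avail_subset] less.prems by metis
qed

lemma serial_unique:
  assumes "serial M \<nu>" "serial M \<nu>'" "i \<in> students M"
  shows "\<nu> i = \<nu>' i"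
  using assms by (intro avail_best_unique) (auto simp: serial_def)

lemma stable_imp_serial:
  assumes "stable_matching M \<nu>"
  shows "serial M \<nu>"
  unfolding serial_def
proof
  fix i assume i: "i \<in> students M"
  have mem: "\<nu> i \<in> options M"
    using assms i by (auto simp: stable_matching_def matching_def)
  have "\<nu> i \<in> avail M \<nu> i"
  proof (cases "\<nu> i")
    case (Some c)
    then have c: "c \<in> colleges M" using mem by (auto simp: options_def)
    have "{j \<in> assigned M \<nu> c. priority M j i} \<subset> assigned M \<nu> c"
      using Some i by (auto simp: assigned_def priority_def)
    then have "card {j \<in> assigned M \<nu> c. priority M j i} < card (assigned M \<nu> c)"
      by (rule psubset_card_mono[OF finite_assigned])
    also have "\<dots> \<le> quota M c"
      using assms c by (auto simp: stable_matching_def matching_def)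
    finally show ?thesis using c Some by (simp add: Some_in_avail)
  qed simp
  moreover have "prefers M i (\<nu> i) y" if y: "y \<in> avail M \<nu> i" "y \<noteq> \<nu> i" for y
  proof (rule ccontr)
    assume "\<not> prefers M i (\<nu> i) y"
    then have *: "prefers M i y (\<nu> i)"
      using prefers_total[OF i, of y "\<nu> i"] mem y avail_subset[of M \<nu> i] by blast
    show False
    proof (cases y)
      case None
      then show False using assms i * by (auto simp: stable_matching_def student_blocks_def)
    next
      case (Some c)
      then have c: "c \<in> colleges M" "card {j \<in> assigned M \<nu> c. priority M j i} < quota M c"
        using y by (auto simp: Some_in_avail)
      then have "\<not> card (assigned M \<nu> c) < quota M c" "\<forall>j\<in>assigned M \<nu> c. \<not> priority M i j"
        using assms i * Some by (auto simp: stable_matching_def pair_blocks_def)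
      \<comment> \<open>Student \<open>i\<close> is not in \<open>c\<close> because
        \<open>y \<noteq> \<nu> i\<close>, so totality puts every student of \<open>c\<close> above
        her. The college is then filled from above, against its availability.\<close>
      moreover from this(2) have "{j \<in> assigned M \<nu> c. priority M j i} = assigned M \<nu> c"
        using priority_total[OF i] y(2) Some by (fastforce simp: assigned_def)
      ultimately show False using c by simp
    qed
  qed
  ultimately show "is_best M i (avail M \<nu> i) (\<nu> i)"
    by (simp add: is_best_def)
qed

text \<open>Availability of one's own choice is exactly the acceptance condition in
  \<open>held\<close>, so a serial profile causes no rejection.\<close>

lemma serial_held:
  assumes "serial M \<nu>"
  shows "held M \<nu> c = assigned M \<nu> c"
proof -
  have "card {j \<in> assigned M \<nu> c. priority M j i} < quota M c" if "i \<in> assigned M \<nu> c" for i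
    using assms that by (auto simp: serial_def is_best_def assigned_def Some_in_avail)
  then show ?thesis by (auto simp: held_def)
qed

lemma serial_tentative:
  assumes "serial M \<nu>" "i \<in> students M"
  shows "tentative M \<nu> i = \<nu> i"
  using assms by (auto simp: tentative_def serial_held assigned_def split: option.splits)

lemma serial_imp_stable:
  assumes "serial M \<nu>"
  shows "stable_matching M (tentative M \<nu>)"
proof -
  let ?\<mu> = "tentative M \<nu>"
  have eq: "assigned M ?\<mu> c = assigned M \<nu> c" for c
    by (simp add: assigned_tentative serial_held assms)
  \<comment> \<open>As nobody is rejected, the bound on held students bounds all applicants.\<close>
  have quota: "card (assigned M \<nu> c) \<le> quota M c" for c
    using card_held[OF M, of \<nu> c] serial_held[OF assms, of c] by simp
  have best: "is_best M i (avail M \<nu> i) (?\<mu> i)" if "i \<in> students M" for i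
    using assms that by (simp add: serial_tentative) (simp add: serial_def)
  have opt: "?\<mu> i \<in> options M" if "i \<in> students M" for i
    using best[OF that] by (auto simp: is_best_def intro: subsetD[OF avail_subset])
  have worse: "y \<notin> avail M \<nu> i" if i: "i \<in> students M" and y: "prefers M i y (?\<mu> i)" "y \<in> options M" for i y
    using best[OF i] prefers_asym[OF i y(2) opt[OF i] y(1)] y by (auto simp: is_best_def)
  show ?thesis
    unfolding stable_matching_def
  proof (intro conjI ballI)
    have "?\<mu> i = None" if "i \<notin> students M" for i
      using that by (auto simp: tentative_def held_def assigned_def split: option.splits)
    then show "matching M ?\<mu>"
      using opt quota by (simp add: matching_def eq)
  next
    fix i assume i: "i \<in> students M"
    show "\<not> student_blocks M ?\<mu> i"
      using worse[OF i, of None] by (auto simp: student_blocks_def options_def)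
    fix c assume c: "c \<in> colleges M"
    show "\<not> pair_blocks M ?\<mu> i c"
    proof
      assume b: "pair_blocks M ?\<mu> i c"
      then have "Some c \<notin> avail M \<nu> i"
        using worse[OF i] c by (auto simp: pair_blocks_def options_def)
      \<comment> \<open>Students above \<open>i\<close> already exhaust the capacity of
        \<open>c\<close>, which leaves no seat for the lower-priority \<open>j\<close> that a
        blocking pair would require.\<close>
      then have ge: "quota M c \<le> card {j \<in> assigned M \<nu> c. priority M j i}"
        using c by (simp add: Some_in_avail)
      also have "\<dots> \<le> card (assigned M \<nu> c)"
        by (intro card_mono finite_assigned) auto
      finally have "\<exists>j\<in>assigned M \<nu> c. priority M i j"
        using b by (simp add: pair_blocks_def eq)
      then obtain j where j: "j \<in> assigned M \<nu> c" "priority M i j" ..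
      then have "\<not> priority M j i"
        by (simp add: priority_def)
      then have "{j \<in> assigned M \<nu> c. priority M j i} \<subset> assigned M \<nu> c"
        using j(1) by blast
      from psubset_card_mono[OF finite_assigned this] show False
        using ge quota[of c] by simp
    qed
  qed
qed

section \<open>Cutoffs and availability\<close>

text \<open>An applicant not above \<open>i\<close> is outranked by everyone above \<open>i\<close>,
  hence by at least \<open>quota M c\<close> applicants, and cannot be held.\<close>

lemma held_full_above:
  assumes "quota M c \<le> card {j \<in> assigned M a c. priority M j i}"
  shows "card (held M a c) = quota M c" and "held M a c \<subseteq> {j. priority M j i}"
proof -
  have "card {j \<in> assigned M a c. priority M j i} \<le> card (assigned M a c)"
    by (intro card_mono finite_assigned) auto
  then show "card (held M a c) = quota M c"
    using assms card_held[OF M, of a c] by simp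
  show "held M a c \<subseteq> {j. priority M j i}"
  proof
    fix k assume k: "k \<in> held M a c"
    have "priority M k i"
    proof (rule ccontr)
      assume "\<not> priority M k i"
      then have "{j \<in> assigned M a c. priority M j i} \<subseteq> {j \<in> assigned M a c. priority M j k}"
        by (auto simp: priority_def)
      then have "card {j \<in> assigned M a c. priority M j i} \<le> card {j \<in> assigned M a c. priority M j k}"
        by (intro card_mono) (auto simp: finite_assigned)
      then show False using assms k by (simp add: held_def)
    qed
    then show "k \<in> {j. priority M j i}" by simp
  qed
qed

lemma cutoff_le_iff:
  assumes i: "i \<in> students M" and c: "c \<in> colleges M"
  shows "cutoff M (tentative M a) c \<le> score M i \<longleftrightarrow>
    card {j \<in> assigned M a c. priority M j i} < quota M c"
proof -
  have pos: "0 < score M i" "0 < quota M c"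
    using M i c by (auto simp: college_admissions_def)
  have fin: "finite (held M a c)"
    using finite_subset[OF held_subset finite_assigned] .
  show ?thesis
  proof (cases "card (held M a c) = quota M c")
    case full: True
    \<comment> \<open>Positive capacity makes the \<open>Min\<close> in the cutoff a genuine
      minimum.\<close>
    then have ne: "held M a c \<noteq> {}" using pos by auto
    have "cutoff M (tentative M a) c \<le> score M i \<longleftrightarrow> (\<exists>j\<in>held M a c. score M j \<le> score M i)"
      using full fin ne by (simp add: cutoff_def assigned_tentative Min_le_iff)
    also have "\<dots> \<longleftrightarrow> \<not> held M a c \<subseteq> {j. priority M j i}"
      by (auto simp: priority_def not_less)
    also have "\<dots> \<longleftrightarrow> card {j \<in> assigned M a c. priority M j i} < quota M c"
    proof
      assume "\<not> held M a c \<subseteq> {j. priority M j i}"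
      then show "card {j \<in> assigned M a c. priority M j i} < quota M c"
        using held_full_above(2) by (meson not_less)
    next
      assume *: "card {j \<in> assigned M a c. priority M j i} < quota M c"
      show "\<not> held M a c \<subseteq> {j. priority M j i}"
      proof
        assume "held M a c \<subseteq> {j. priority M j i}"
        then have "held M a c \<subseteq> {j \<in> assigned M a c. priority M j i}"
          using held_subset by fast
        then have "card (held M a c) \<le> card {j \<in> assigned M a c. priority M j i}"
          by (intro card_mono) (auto simp: finite_assigned)
        then show False using * full by simp
      qed
    qed
    finally show ?thesis .
  next
    case False
    \<comment> \<open>With a vacancy the cutoff is 0, below every score, and by
      \<open>held_full_above\<close> the applicants above \<open>i\<close> cannot fill the
      college.\<close>
    then show ?thesis
      using pos held_full_above(1)[of c a i]
      by (cases "card {j \<in> assigned M a c. priority M j i} < quota M c")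
        (auto simp: cutoff_def assigned_tentative)
  qed
qed

section \<open>Dynamics of straightforward play\<close>

text \<open>Replaces cutoffs by availability at the previous application profile; the later
  arguments use only this form for rounds after the first.\<close>

lemma straightforward_Suc:
  assumes "i \<in> students M" "1 \<le> t"
  shows "straightforward M a i (Suc t) \<longleftrightarrow>
    (if tentative M (a t) i \<noteq> None then a (Suc t) i = tentative M (a t) i
     else is_best M i (avail M (a t) i) (a (Suc t) i))"
proof -
  have "{c \<in> colleges M. cutoff M (tentative M (a t)) c \<le> score M i} =
      {c \<in> colleges M. card {j \<in> assigned M (a t) c. priority M j i} < quota M c}"
    using cutoff_le_iff[OF assms(1)] by auto
  then show ?thesis
    using assms by (simp add: straightforward_def Let_def avail_def)
qed

lemma straightforward_first:
  assumes "straightforward M a i 1"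
  shows "a 1 i \<in> options M"
  using assms by (simp add: straightforward_def is_best_def)

text \<open>Held students apply again, so a college filled from above \<open>i\<close> remains so in
  the next round.\<close>

lemma avail_antimono:
  assumes "\<forall>i\<in>students M. straightforward M a i (Suc t)" "1 \<le> t"
  shows "avail M (a (Suc t)) i \<subseteq> avail M (a t) i"
proof -
  have sub: "held M (a t) c \<subseteq> assigned M (a (Suc t)) c" for c
  proof
    fix j assume j: "j \<in> held M (a t) c"
    then have "j \<in> students M" "tentative M (a t) j = Some c"
      using held_subset[of M "a t" c] by (auto simp: assigned_def tentative_def)
    then show "j \<in> assigned M (a (Suc t)) c"
      using assms straightforward_Suc[of j t a] by (simp add: assigned_def)
  qed
  have "card {j \<in> assigned M (a t) c. priority M j i} < quota M c"
    if *: "card {j \<in> assigned M (a (Suc t)) c. priority M j i} < quota M c" for c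
  proof (rule ccontr)
    assume "\<not> ?thesis"
    then have full: "card (held M (a t) c) = quota M c" "held M (a t) c \<subseteq> {j. priority M j i}"
      using held_full_above[of c "a t" i] by (auto simp: not_less)
    then have "held M (a t) c \<subseteq> {j \<in> assigned M (a (Suc t)) c. priority M j i}"
      using sub by fast
    then have "card (held M (a t) c) \<le> card {j \<in> assigned M (a (Suc t)) c. priority M j i}"
      by (intro card_mono) (auto simp: finite_assigned)
    then show False using * full by simp
  qed
  then show ?thesis by (auto simp: avail_def)
qed

lemma application_beats_avail:
  assumes "\<forall>i\<in>students M. \<forall>t\<in>{1..T}. straightforward M a i t"
    and i: "i \<in> students M" and "1 \<le> t" "t \<le> T" "y \<in> avail M (a t) i" "y \<noteq> a t i"
  shows "prefers M i (a t i) y"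
  using assms(3-)
proof (induction t arbitrary: y rule: dec_induct)
  case base
  have "straightforward M a i 1" using assms(1) i base by auto
  moreover have "y \<in> options M" using base.prems by (blast intro: subsetD[OF avail_subset])
  ultimately show ?case
    using base.prems by (simp add: straightforward_def is_best_def)
next
  case (step t)
  have s: "\<forall>i\<in>students M. straightforward M a i (Suc t)"
    using assms(1) step.prems by auto
  have y: "y \<in> avail M (a t) i"
    using avail_antimono[OF s] step by blast
  show ?case
  proof (cases "tentative M (a t) i = None")
    case True
    then show ?thesis
      using s i y step straightforward_Suc[of i t a] by (auto simp: is_best_def)
  next
    case False
    then have "a (Suc t) i = a t i"
      using s i step straightforward_Suc[of i t a] tentative_cases[of M "a t" i] by auto
    then show ?thesis using step y by auto
  qed
qed

text \<open>Availability lags by one round: a repeated application was accepted in round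
  \<open>t\<close>, and a new one was chosen from the set of round \<open>t\<close>.\<close>

lemma application_avail_before:
  assumes "\<forall>i\<in>students M. \<forall>t\<in>{1..T}. straightforward M a i t"
    and i: "i \<in> students M" and t: "1 \<le> t" "Suc t \<le> T"
  shows "a (Suc t) i \<in> avail M (a t) i"
proof (cases "tentative M (a t) i")
  case None
  then show ?thesis
    using assms straightforward_Suc[of i t a] by (auto simp: is_best_def)
next
  case (Some c)
  have s: "a (Suc t) i = Some c"
    using assms Some straightforward_Suc[of i t a] by auto
  have h: "i \<in> held M (a t) c"
    using Some by (auto simp: tentative_def split: option.splits if_splits)
  \<comment> \<open>\<open>held\<close> does not restrict \<open>c\<close> to colleges, so
    membership is traced back to the choice in round 1.\<close>
  have "c \<in> colleges M"
  proof -
    have "a t i \<in> options M" if "1 \<le> t" "t \<le> T" for t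
      using that
    proof (induction t rule: dec_induct)
      case base
      then show ?case using assms(1) i by (intro straightforward_first) auto
    next
      case (step t)
      then show ?case
        using assms(1) i straightforward_Suc[of i t a] tentative_cases[of M "a t" i]
          avail_subset[of M "a t" i]
        by (auto simp: is_best_def split: if_splits)
    qed
    from this[of "Suc t"] show ?thesis using s t by (auto simp: options_def)
  qed
  then show ?thesis using h s by (simp add: Some_in_avail held_def)
qed

text \<open>Ranks start at 0, so the student of rank \<open>r\<close> is settled from round
  \<open>r + 1\<close> on. What has to be shown is that her application is available in the same
  round.\<close>

lemma application_settled:
  assumes "\<forall>i\<in>students M. \<forall>t\<in>{1..T}. straightforward M a i t"
    and "i \<in> students M" "rank M i < t" "t \<le> T"
  shows "is_best M i (avail M (a t) i) (a t i)"
  using assms(2-)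
proof (induction "rank M i" arbitrary: i t rule: less_induct)
  case less
  have "a t i \<in> avail M (a t) i"
  proof (cases "t = 1")
    case True
    \<comment> \<open>In round 1 only rank 0 is possible: nobody is above \<open>i\<close>, and
      positive capacities leave every college available.\<close>
    then have "{j \<in> students M. priority M j i} = {}"
      using less.prems finite_students by (simp add: rank_def)
    then have none: "{j \<in> assigned M (a t) c. priority M j i} = {}" for c
      by (auto simp: assigned_def)
    have "avail M (a t) i = options M"
      using M by (auto simp: avail_def none options_def college_admissions_def)
    then show ?thesis
      using assms(1) less.prems straightforward_first[of a i] unfolding True by auto
  next
    case False
    then obtain u where u: "t = Suc u" "1 \<le> u"
      using less.prems by (cases t) auto
    \<comment> \<open>Everyone above \<open>i\<close> has smaller rank and is thus settled in both
      \<open>u\<close> and \<open>t\<close>. By uniqueness their applications agree, which removes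
      the one-round lag.\<close>
    have "a t j = a u j" if j: "j \<in> students M" "priority M j i" for j
    proof (rule avail_best_unique[OF j(1)])
      fix k assume k: "k \<in> students M" "k = j \<or> priority M k j"
      then have "priority M k i" using j by (auto simp: priority_def)
      then have "rank M k < rank M i" using rank_mono k by blast
      then show "is_best M k (avail M (a t) k) (a t k)" "is_best M k (avail M (a u) k) (a u k)"
        using less.hyps[of k] less.prems k u by auto
    qed
    then have "avail M (a t) i = avail M (a u) i"
      by (rule avail_cong)
    then show ?thesis
      using application_avail_before[OF assms(1) less.prems(1)] u less.prems by simp
  qed
  then show ?case
    using application_beats_avail[OF assms(1) less.prems(1)] less.prems by (auto simp: is_best_def)
qed

section \<open>Termination and the final outcome\<close>

lemma serial_after_card_rounds:
  assumes "\<forall>i\<in>students M. \<forall>t\<in>{1..T}. straightforward M a i t" "card (students M) \<le> t" "t \<le> T"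
  shows "serial M (a t)"
  unfolding serial_def
proof
  fix i assume i: "i \<in> students M"
  show "is_best M i (avail M (a t) i) (a t i)"
    using application_settled[OF assms(1) i] rank_less_card[OF i] assms by simp
qed

text \<open>The process may stop before \<open>card (students M)\<close> rounds, so its outcome is
  derived from the absence of revisions: a repeated application is available without lag.\<close>

lemma serial_if_no_revision:
  assumes "\<forall>i\<in>students M. \<forall>t\<ge>1. straightforward M a i t"
    and rev: "\<forall>i\<in>students M. \<not> revises a i (R + 1)"
  shows "serial M (a R)"
  unfolding serial_def
proof
  fix i assume i: "i \<in> students M"
  \<comment> \<open>First applications count as revisions, so the presence of \<open>i\<close>
    excludes \<open>R = 0\<close>.\<close>
  have R: "1 \<le> R" "a (Suc R) i = a R i"
    using rev i by (auto simp: revises_def)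
  have s: "\<forall>i\<in>students M. \<forall>t\<in>{1..Suc R}. straightforward M a i t"
    using assms(1) by simp
  show "is_best M i (avail M (a R) i) (a R i)"
    using application_avail_before[OF s i R(1)] application_beats_avail[OF s i R(1)] R
    by (auto simp: is_best_def)
qed

lemma process_ends:
  assumes "\<forall>i\<in>students M. \<forall>t\<ge>1. straightforward M a i t"
  shows "\<exists>R\<le>card (students M). ends_after M a R"
proof -
  let ?n = "card (students M)"
  let ?P = "\<lambda>R. \<forall>i\<in>students M. \<not> revises a i (R + 1)"
  have s: "\<forall>i\<in>students M. \<forall>t\<in>{1..?n + 1}. straightforward M a i t"
    using assms by simp
  have P: "?P ?n"
  proof
    fix i assume i: "i \<in> students M"
    then have "0 < ?n" using rank_less_card by fastforce
    \<comment> \<open>Both rounds are late enough to be serial, and serial profiles agree on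
      students.\<close>
    moreover have "a (?n + 1) i = a ?n i"
      by (intro serial_unique serial_after_card_rounds[OF s] i) auto
    ultimately show "\<not> revises a i (?n + 1)" by (simp add: revises_def)
  qed
  define R where "R = (LEAST R. ?P R)"
  \<comment> \<open>By minimality of \<open>R\<close>, the condition fails at \<open>t - 1\<close>,
    which means a revision in round \<open>t\<close>.\<close>
  have "\<exists>i\<in>students M. revises a i t" if t: "t \<in> {1..R}" for t
    using not_less_Least[of "t - 1" ?P] t unfolding R_def by fastforce
  moreover have "?P R" "R \<le> ?n"
    unfolding R_def by (rule LeastI[of ?P, OF P], rule Least_le[of ?P, OF P])
  ultimately show ?thesis unfolding ends_after_def by blast
qed

end

theorem proposition1:
  fixes M :: "('i, 'c) market"
  assumes "college_admissions M"
  shows "\<exists>\<mu>. stable_matching M \<mu> \<and> (\<forall>\<nu>. stable_matching M \<nu> \<longrightarrow> \<nu> = \<mu>) \<and>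
    (\<forall>a. (\<forall>i\<in>students M. \<forall>t\<ge>1. straightforward M a i t) \<longrightarrow>
       (\<exists>R\<le>card (students M). ends_after M a R \<and> tentative M (a R) = \<mu>)) \<and>
    (\<forall>T\<ge>card (students M). \<forall>a. (\<forall>i\<in>students M. \<forall>t\<in>{1..T}. straightforward M a i t) \<longrightarrow>
       tentative M (a T) = \<mu>)"
proof -
  note M = assms
  let ?n = "card (students M)"
  \<comment> \<open>Existence of a stable matching comes from the process itself: any
    straightforward play yields one.\<close>
  obtain b where "\<forall>i\<in>students M. \<forall>t\<ge>1. straightforward M b i t"
    using straightforward_play_exists[OF M] by blast
  then have b: "serial M (b ?n)"
    by (intro serial_after_card_rounds[OF M, of ?n]) auto
  define \<mu> where "\<mu> = tentative M (b ?n)"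
  have stable: "stable_matching M \<mu>"
    unfolding \<mu>_def by (rule serial_imp_stable[OF M b])
  \<comment> \<open>Serial profiles agree on students only; applying \<open>tentative\<close> turns
    this into equality of functions.\<close>
  have eq: "tentative M \<nu> = \<mu>" if "serial M \<nu>" for \<nu>
    unfolding \<mu>_def using serial_unique[OF M that b] by (intro tentative_cong)
  show ?thesis
  proof (intro exI[of _ \<mu>] conjI allI impI)
    show "stable_matching M \<mu>" by (rule stable)
  next
    fix \<nu> assume \<nu>: "stable_matching M \<nu>"
    have "\<nu> i = \<mu> i" for i
    proof (cases "i \<in> students M")
      case True
      then show ?thesis
        using serial_unique[OF M stable_imp_serial[OF M \<nu>] stable_imp_serial[OF M stable]] by blast
    next
      case False
      then show ?thesis using \<nu> stable by (simp add: stable_matching_def matching_def)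
    qed
    then show "\<nu> = \<mu>" by blast
  next
    fix a assume a: "\<forall>i\<in>students M. \<forall>t\<ge>1. straightforward M a i t"
    obtain R where R: "R \<le> ?n" "ends_after M a R"
      using process_ends[OF M a] by blast
    then have "tentative M (a R) = \<mu>"
      by (intro eq serial_if_no_revision[OF M a]) (simp add: ends_after_def)
    then show "\<exists>R\<le>?n. ends_after M a R \<and> tentative M (a R) = \<mu>"
      using R by blast
  next
    fix T a assume "?n \<le> T" "\<forall>i\<in>students M. \<forall>t\<in>{1..T}. straightforward M a i t"
    then show "tentative M (a T) = \<mu>"
      by (intro eq serial_after_card_rounds[OF M]) auto
  qed
qed

end
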